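(* Let $E_1,\dots,E_m,F$ be Banach spaces and let $\mathfrak{P}$ be a property of bounded sequences in $E_1\times\cdots\times E_m$. Then the set of continuous $m$-linear operators $A\colon E_1\times\cdots\times E_m\to F$ that send bounded sequences having property $\mathfrak{P}$ to norm null sequences is a closed subspace of $\mathcal{L}(E_1,\dots,E_m;F)$.
   Context: $\mathcal{L}(E_1,\dots,E_m;F)$ is the Banach space of continuous $m$-linear operators with the usual norm $\|A\|=\sup\{\|A(x_1,\dots,x_m)\| : \|x_i\|\le 1\}$. The product $E_1\times\cdots\times E_m$ carries the maximum norm. *)

theory Defs
  imports "HOL-Analysis.Abstract_Metric_Spaces" "HOL-Algebra.Algebraic_Closure_Type"
begin

text \<open>
  The spaces \<open>E\<^sub>1, \<dots>, E\<^sub>m\<close> are unrelated and \<open>m\<close> is arbitrary, so normed spaces are treated as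
  objects with a carrier set, extending the modules of HOL-Algebra by a norm. The inherited ring
  fields \<open>mult\<close> and \<open>one\<close> play no role. The scalars form a type of class \<open>real_normed_field\<close>:
  up to isometric isomorphism this is the real or the complex field.
\<close>

record ('k, 'a) normed_module = "('k, 'a) module" +
  vnorm :: "'a \<Rightarrow> real"

locale normed_space = module ring_of_type_algebra V
  for V :: "('k::real_normed_field, 'a) normed_module" (structure) +
  assumes vnorm_eq_0: "x \<in> carrier V \<Longrightarrow> vnorm V x = 0 \<longleftrightarrow> x = \<zero>\<^bsub>V\<^esub>"
    and vnorm_triangle:
      "x \<in> carrier V \<Longrightarrow> y \<in> carrier V \<Longrightarrow> vnorm V (x \<oplus>\<^bsub>V\<^esub> y) \<le> vnorm V x + vnorm V y"
    and vnorm_smult: "x \<in> carrier V \<Longrightarrow> vnorm V (a \<odot>\<^bsub>V\<^esub> x) = norm a * vnorm V x"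
    and vnorm_nonneg: "x \<in> carrier V \<Longrightarrow> 0 \<le> vnorm V x"

text \<open>
  The locale \<open>Metric_space\<close> requires symmetry and nonnegativity of the distance on the whole type,
  hence the value 0 outside the carrier.
\<close>

definition vdist :: "('k, 'a) normed_module \<Rightarrow> 'a \<Rightarrow> 'a \<Rightarrow> real" where
  "vdist V x y = (if x \<in> carrier V \<and> y \<in> carrier V then vnorm V (x \<ominus>\<^bsub>V\<^esub> y) else 0)"

abbreviation norm_topology :: "('k, 'a) normed_module \<Rightarrow> 'a topology" where
  "norm_topology V \<equiv> Metric_space.mtopology (carrier V) (vdist V)"

locale Banach_space = normed_space +
  assumes complete: "Metric_space.mcomplete (carrier V) (vdist V)"

definition bounded_seq :: "('k, 'a) normed_module \<Rightarrow> (nat \<Rightarrow> 'a) \<Rightarrow> bool" where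
  "bounded_seq V x \<longleftrightarrow> range x \<subseteq> carrier V \<and> (\<exists>B. \<forall>n. vnorm V (x n) \<le> B)"

definition norm_null_seq :: "('k, 'a) normed_module \<Rightarrow> (nat \<Rightarrow> 'a) \<Rightarrow> bool" where
  "norm_null_seq V x \<longleftrightarrow> range x \<subseteq> carrier V \<and> (\<lambda>n. vnorm V (x n)) \<longlonglongrightarrow> 0"

definition prod_space :: "nat \<Rightarrow> (nat \<Rightarrow> ('k, 'a) normed_module) \<Rightarrow> ('k, nat \<Rightarrow> 'a) normed_module"
  where
  "prod_space m E =
    \<lparr> carrier = (\<Pi>\<^sub>E i\<in>{1..m}. carrier (E i)),
      monoid.mult = undefined,
      one = undefined,
      ring.zero = (\<lambda>i\<in>{1..m}. \<zero>\<^bsub>E i\<^esub>),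
      add = (\<lambda>x y. \<lambda>i\<in>{1..m}. x i \<oplus>\<^bsub>E i\<^esub> y i),
      module.smult = (\<lambda>a x. \<lambda>i\<in>{1..m}. a \<odot>\<^bsub>E i\<^esub> x i),
      vnorm = (\<lambda>x. MAX i\<in>{1..m}. vnorm (E i) (x i)) \<rparr>"

definition multilinear ::
  "nat \<Rightarrow> (nat \<Rightarrow> ('k, 'a) normed_module) \<Rightarrow> ('k, 'b) normed_module \<Rightarrow> ((nat \<Rightarrow> 'a) \<Rightarrow> 'b) \<Rightarrow> bool"
  where
  "multilinear m E F A \<longleftrightarrow>
    (\<forall>x \<in> carrier (prod_space m E). \<forall>i \<in> {1..m}. \<forall>u \<in> carrier (E i). \<forall>v \<in> carrier (E i). \<forall>a.
      A (x(i := u \<oplus>\<^bsub>E i\<^esub> v)) = A (x(i := u)) \<oplus>\<^bsub>F\<^esub> A (x(i := v)) \<and>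
      A (x(i := a \<odot>\<^bsub>E i\<^esub> u)) = a \<odot>\<^bsub>F\<^esub> A (x(i := u)))"

text \<open>
  The space \<open>\<L>(E\<^sub>1, \<dots>, E\<^sub>m; F)\<close>. Its elements are extensional functions (\<open>undefined\<close> outside the
  product), so that equality of operators is equality on \<open>E\<^sub>1 \<times> \<dots> \<times> E\<^sub>m\<close>.
\<close>

definition mlin_space ::
  "nat \<Rightarrow> (nat \<Rightarrow> ('k, 'a) normed_module) \<Rightarrow> ('k, 'b) normed_module \<Rightarrow>
    ('k, (nat \<Rightarrow> 'a) \<Rightarrow> 'b) normed_module"
  where
  "mlin_space m E F =
    \<lparr> carrier = {A \<in> carrier (prod_space m E) \<rightarrow>\<^sub>E carrier F. multilinear m E F A \<and>
        continuous_map (norm_topology (prod_space m E)) (norm_topology F) A},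
      monoid.mult = undefined,
      one = undefined,
      ring.zero = (\<lambda>x\<in>carrier (prod_space m E). \<zero>\<^bsub>F\<^esub>),
      add = (\<lambda>A B. \<lambda>x\<in>carrier (prod_space m E). A x \<oplus>\<^bsub>F\<^esub> B x),
      module.smult = (\<lambda>a A. \<lambda>x\<in>carrier (prod_space m E). a \<odot>\<^bsub>F\<^esub> A x),
      vnorm = (\<lambda>A. SUP x\<in>{x \<in> carrier (prod_space m E). \<forall>i\<in>{1..m}. vnorm (E i) (x i) \<le> 1}.
        vnorm F (A x)) \<rparr>"

text \<open>Over the scalar field, a \<open>submodule\<close> is a linear subspace.\<close>

definition closed_subspace :: "'a set \<Rightarrow> ('k::real_normed_field, 'a) normed_module \<Rightarrow> bool" where
  "closed_subspace S V \<longleftrightarrow>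
    submodule S (ring_of_type_algebra :: 'k ring) V \<and> closedin (norm_topology V) S"

end

theory Submission
  imports Defs
begin

text \<open>
  Write \<open>S\<close> for the set of operators in question. It is a subspace because null sequences in \<open>F\<close>
  are closed under sums and scalar multiples, and these operations are pointwise on operators.

  It is closed because a bounded sequence \<open>x\<close> satisfies \<open>\<parallel>x n\<parallel> \<le> R\<close> for some \<open>R > 0\<close>, and evaluation
  of \<open>m\<close>-linear operators on the ball of radius \<open>R\<close> is controlled by the operator norm:
  \<open>\<parallel>A (x n)\<parallel> \<le> R ^ m * \<parallel>A\<parallel>\<close> (lemma \<open>vnorm_apply_le_power\<close>). Hence, if \<open>A\<close> is close to \<open>L\<close> in operator
  norm, then \<open>A (x n)\<close> is close to \<open>L (x n)\<close> uniformly in \<open>n\<close>, and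
  \<open>\<parallel>L (x n)\<parallel> \<le> \<parallel>(L - A) (x n)\<parallel> + \<parallel>A (x n)\<parallel>\<close> is eventually small whenever \<open>A (x n)\<close> tends to \<open>0\<close>
  (lemma \<open>norm_null_seq_of_approximations\<close>). The sequences on which the operators are tested
  enter one at a time, so any property \<open>P\<close> may select them.

  Most of the work is to establish that the operators form a normed space at all, so that their
  topology is a metric one. The essential point there is that the supremum defining the operator
  norm is finite (lemma \<open>bounded_on_unit_ball\<close>): continuity at the origin bounds an operator on a
  small ball, and homogeneity of degree \<open>m\<close> transports the bound to the unit ball.
\<close>

section \<open>Normed spaces with a carrier\<close>

lemma ring_of_type_algebra_simps [simp]:
  "carrier (ring_of_type_algebra :: 'k::ring_1 ring) = UNIV"
  "x \<oplus>\<^bsub>(ring_of_type_algebra :: 'k ring)\<^esub> y = x + y"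
  "x \<otimes>\<^bsub>(ring_of_type_algebra :: 'k ring)\<^esub> y = x * y"
  "\<zero>\<^bsub>(ring_of_type_algebra :: 'k ring)\<^esub> = 0"
  "\<one>\<^bsub>(ring_of_type_algebra :: 'k ring)\<^esub> = 1"
  by (simp_all add: ring_of_type_algebra_def)

lemma norm_null_seq_iff:
  "norm_null_seq V x \<longleftrightarrow> (\<forall>n. x n \<in> carrier V) \<and> (\<lambda>n. vnorm V (x n)) \<longlonglongrightarrow> 0"
  by (simp add: norm_null_seq_def image_subset_iff)

text \<open>
  Both the product and the operator space are shown to be normed spaces by this rule. It does not ask
  for additive inverses, since \<open>(-1) \<odot> x\<close> is one as soon as \<open>0 \<odot> x\<close> is the zero vector.
\<close>

lemma normed_spaceI:
  fixes V :: "('k::real_normed_field, 'a) normed_module"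
  assumes zero_closed: "\<zero>\<^bsub>V\<^esub> \<in> carrier V"
    and add_closed: "\<And>x y. x \<in> carrier V \<Longrightarrow> y \<in> carrier V \<Longrightarrow> x \<oplus>\<^bsub>V\<^esub> y \<in> carrier V"
    and smult_closed: "\<And>a x. x \<in> carrier V \<Longrightarrow> a \<odot>\<^bsub>V\<^esub> x \<in> carrier V"
    and add_assoc: "\<And>x y z. x \<in> carrier V \<Longrightarrow> y \<in> carrier V \<Longrightarrow> z \<in> carrier V \<Longrightarrow>
        (x \<oplus>\<^bsub>V\<^esub> y) \<oplus>\<^bsub>V\<^esub> z = x \<oplus>\<^bsub>V\<^esub> (y \<oplus>\<^bsub>V\<^esub> z)"
    and add_commute: "\<And>x y. x \<in> carrier V \<Longrightarrow> y \<in> carrier V \<Longrightarrow> x \<oplus>\<^bsub>V\<^esub> y = y \<oplus>\<^bsub>V\<^esub> x"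
    and add_zero: "\<And>x. x \<in> carrier V \<Longrightarrow> \<zero>\<^bsub>V\<^esub> \<oplus>\<^bsub>V\<^esub> x = x"
    and zero_smult: "\<And>x. x \<in> carrier V \<Longrightarrow> 0 \<odot>\<^bsub>V\<^esub> x = \<zero>\<^bsub>V\<^esub>"
    and one_smult: "\<And>x. x \<in> carrier V \<Longrightarrow> 1 \<odot>\<^bsub>V\<^esub> x = x"
    and smult_add_left: "\<And>a b x. x \<in> carrier V \<Longrightarrow>
        (a + b) \<odot>\<^bsub>V\<^esub> x = a \<odot>\<^bsub>V\<^esub> x \<oplus>\<^bsub>V\<^esub> b \<odot>\<^bsub>V\<^esub> x"
    and smult_add_right: "\<And>a x y. x \<in> carrier V \<Longrightarrow> y \<in> carrier V \<Longrightarrow>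
        a \<odot>\<^bsub>V\<^esub> (x \<oplus>\<^bsub>V\<^esub> y) = a \<odot>\<^bsub>V\<^esub> x \<oplus>\<^bsub>V\<^esub> a \<odot>\<^bsub>V\<^esub> y"
    and smult_smult: "\<And>a b x. x \<in> carrier V \<Longrightarrow> (a * b) \<odot>\<^bsub>V\<^esub> x = a \<odot>\<^bsub>V\<^esub> (b \<odot>\<^bsub>V\<^esub> x)"
    and norm_nonneg: "\<And>x. x \<in> carrier V \<Longrightarrow> 0 \<le> vnorm V x"
    and norm_definite: "\<And>x. x \<in> carrier V \<Longrightarrow> vnorm V x = 0 \<Longrightarrow> x = \<zero>\<^bsub>V\<^esub>"
    and norm_triangle: "\<And>x y. x \<in> carrier V \<Longrightarrow> y \<in> carrier V \<Longrightarrow>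
        vnorm V (x \<oplus>\<^bsub>V\<^esub> y) \<le> vnorm V x + vnorm V y"
    and norm_smult: "\<And>a x. x \<in> carrier V \<Longrightarrow> vnorm V (a \<odot>\<^bsub>V\<^esub> x) = norm a * vnorm V x"
  shows "normed_space V"
proof -
  have inv: "\<exists>y\<in>carrier V. y \<oplus>\<^bsub>V\<^esub> x = \<zero>\<^bsub>V\<^esub>" if "x \<in> carrier V" for x
    using smult_add_left[of x "-1" 1] that
    by (intro bexI[of _ "(-1) \<odot>\<^bsub>V\<^esub> x"]) (simp_all add: one_smult zero_smult smult_closed)
  have "abelian_group V"
    by (rule abelian_groupI) (assumption | rule assms(1-6) inv)+
  then have "module ring_of_type_algebra V"
    by (intro moduleI)
       (simp_all add: cring_from_type_algebra smult_closed smult_add_left smult_add_right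
         smult_smult one_smult)
  moreover have "vnorm V \<zero>\<^bsub>V\<^esub> = 0"
    using norm_smult[of "\<zero>\<^bsub>V\<^esub>" 0] zero_smult zero_closed by simp
  ultimately show ?thesis
    using norm_nonneg norm_definite norm_triangle norm_smult
    by (intro normed_space.intro normed_space_axioms.intro) blast+
qed

context normed_space
begin

lemma zero_smult: "x \<in> carrier V \<Longrightarrow> 0 \<odot>\<^bsub>V\<^esub> x = \<zero>\<^bsub>V\<^esub>"
  using smult_l_null by simp

lemma one_smult: "x \<in> carrier V \<Longrightarrow> 1 \<odot>\<^bsub>V\<^esub> x = x"
  using smult_one by simp

lemma smult_zero: "a \<odot>\<^bsub>V\<^esub> \<zero>\<^bsub>V\<^esub> = \<zero>\<^bsub>V\<^esub>"
  using smult_r_null by simp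

lemma smult_smult: "x \<in> carrier V \<Longrightarrow> a \<odot>\<^bsub>V\<^esub> (b \<odot>\<^bsub>V\<^esub> x) = (a * b) \<odot>\<^bsub>V\<^esub> x"
  using smult_assoc1[of a b x] by simp

lemma smult_in_carrier: "x \<in> carrier V \<Longrightarrow> a \<odot>\<^bsub>V\<^esub> x \<in> carrier V"
  using smult_closed by simp

lemma smult_add_left:
  "x \<in> carrier V \<Longrightarrow> (a + b) \<odot>\<^bsub>V\<^esub> x = a \<odot>\<^bsub>V\<^esub> x \<oplus>\<^bsub>V\<^esub> b \<odot>\<^bsub>V\<^esub> x"
  using smult_l_distr[of a b x] by simp

lemma smult_add_right:
  "x \<in> carrier V \<Longrightarrow> y \<in> carrier V \<Longrightarrow>
    a \<odot>\<^bsub>V\<^esub> (x \<oplus>\<^bsub>V\<^esub> y) = a \<odot>\<^bsub>V\<^esub> x \<oplus>\<^bsub>V\<^esub> a \<odot>\<^bsub>V\<^esub> y"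
  using smult_r_distr[of a x y] by simp

lemma uminus_eq_smult: 
  assumes "x \<in> carrier V"
  shows "\<ominus>\<^bsub>V\<^esub> x = (-1) \<odot>\<^bsub>V\<^esub> x"
proof (rule M.minus_equality)
  show "(-1) \<odot>\<^bsub>V\<^esub> x \<oplus>\<^bsub>V\<^esub> x = \<zero>\<^bsub>V\<^esub>"
    using smult_add_left[of x "-1" 1] assms by (simp add: zero_smult one_smult)
qed (simp_all add: assms smult_in_carrier)

lemma minus_eq_smult:
  "x \<in> carrier V \<Longrightarrow> y \<in> carrier V \<Longrightarrow> x \<ominus>\<^bsub>V\<^esub> y = x \<oplus>\<^bsub>V\<^esub> (-1) \<odot>\<^bsub>V\<^esub> y"
  by (simp add: a_minus_def uminus_eq_smult)

lemma vnorm_zero: "vnorm V \<zero>\<^bsub>V\<^esub> = 0"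
  using vnorm_eq_0 by blast

lemma vnorm_uminus: "x \<in> carrier V \<Longrightarrow> vnorm V (\<ominus>\<^bsub>V\<^esub> x) = vnorm V x"
  by (simp add: uminus_eq_smult vnorm_smult)

lemma minus_add_minus:
  assumes "x \<in> carrier V" "y \<in> carrier V" "z \<in> carrier V"
  shows "(x \<ominus>\<^bsub>V\<^esub> y) \<oplus>\<^bsub>V\<^esub> (y \<ominus>\<^bsub>V\<^esub> z) = x \<ominus>\<^bsub>V\<^esub> z"
  using assms by (simp add: a_minus_def M.a_assoc M.r_neg1 M.r_neg2)

lemma minus_eq_zero_iff:
  assumes "x \<in> carrier V" "y \<in> carrier V"
  shows "x \<ominus>\<^bsub>V\<^esub> y = \<zero>\<^bsub>V\<^esub> \<longleftrightarrow> x = y"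
proof
  assume "x \<ominus>\<^bsub>V\<^esub> y = \<zero>\<^bsub>V\<^esub>"
  then show "x = y"
    using M.minus_equality[of x "\<ominus>\<^bsub>V\<^esub> y"] assms by (simp add: a_minus_def)
qed (use assms in \<open>simp add: a_minus_def M.r_neg\<close>)

lemma Metric_space_vdist: "Metric_space (carrier V) (vdist V)"
proof
  fix x y z
  show "0 \<le> vdist V x y"
    by (simp add: vdist_def vnorm_nonneg)
  show "vdist V x y = vdist V y x"
  proof (cases "x \<in> carrier V \<and> y \<in> carrier V")
    case True
    then have "y \<ominus>\<^bsub>V\<^esub> x = \<ominus>\<^bsub>V\<^esub> (x \<ominus>\<^bsub>V\<^esub> y)"
      by (simp add: a_minus_def M.minus_add M.a_comm)
    with True show ?thesis
      by (simp add: vdist_def vnorm_uminus)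
  qed (auto simp: vdist_def)
  show "vdist V x y = 0 \<longleftrightarrow> x = y" if "x \<in> carrier V" "y \<in> carrier V"
    using that by (simp add: vdist_def vnorm_eq_0 minus_eq_zero_iff)
  show "vdist V x z \<le> vdist V x y + vdist V y z"
    if "x \<in> carrier V" "y \<in> carrier V" "z \<in> carrier V"
    using that vnorm_triangle[of "x \<ominus>\<^bsub>V\<^esub> y" "y \<ominus>\<^bsub>V\<^esub> z"]
    by (simp add: vdist_def minus_add_minus)
qed

lemma vdist_zero_left: "x \<in> carrier V \<Longrightarrow> vdist V \<zero>\<^bsub>V\<^esub> x = vnorm V x"
  by (simp add: vdist_def a_minus_def vnorm_uminus)

sublocale norm: Metric_space "carrier V" "vdist V"
  by (rule Metric_space_vdist)

lemma vdist_add_le: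
  assumes "x \<in> carrier V" "x' \<in> carrier V" "y \<in> carrier V" "y' \<in> carrier V"
  shows "vdist V (x \<oplus>\<^bsub>V\<^esub> y) (x' \<oplus>\<^bsub>V\<^esub> y') \<le> vdist V x x' + vdist V y y'"
proof -
  have "(x \<oplus>\<^bsub>V\<^esub> y) \<ominus>\<^bsub>V\<^esub> (x' \<oplus>\<^bsub>V\<^esub> y') = (x \<ominus>\<^bsub>V\<^esub> x') \<oplus>\<^bsub>V\<^esub> (y \<ominus>\<^bsub>V\<^esub> y')"
    using assms by (simp add: a_minus_def M.minus_add M.a_ac)
  then show ?thesis
    using assms vnorm_triangle[of "x \<ominus>\<^bsub>V\<^esub> x'" "y \<ominus>\<^bsub>V\<^esub> y'"] by (simp add: vdist_def)
qed

lemma vdist_smult: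
  assumes "x \<in> carrier V" "y \<in> carrier V"
  shows "vdist V (a \<odot>\<^bsub>V\<^esub> x) (a \<odot>\<^bsub>V\<^esub> y) = norm a * vdist V x y"
proof -
  have "a \<odot>\<^bsub>V\<^esub> x \<ominus>\<^bsub>V\<^esub> a \<odot>\<^bsub>V\<^esub> y = a \<odot>\<^bsub>V\<^esub> (x \<ominus>\<^bsub>V\<^esub> y)"
    using assms
    by (simp add: minus_eq_smult smult_in_carrier smult_add_right smult_smult mult.commute)
  then show ?thesis
    using assms by (simp add: vdist_def vnorm_smult smult_in_carrier)
qed

lemma continuous_map_add:
  fixes T :: "'c topology"
  assumes f: "continuous_map T (norm_topology V) f"
    and g: "continuous_map T (norm_topology V) g"
  shows "continuous_map T (norm_topology V) (\<lambda>x. f x \<oplus>\<^bsub>V\<^esub> g x)"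
  unfolding norm.continuous_map_to_metric
proof (intro ballI allI impI)
  fix x and e :: real
  assume x: "x \<in> topspace T" and "e > 0"
  from \<open>e > 0\<close> have "e / 2 > 0" by simp
  obtain U where U: "openin T U" "x \<in> U" "\<forall>y\<in>U. f y \<in> norm.mball (f x) (e / 2)"
    using f[unfolded norm.continuous_map_to_metric, rule_format, OF x \<open>e / 2 > 0\<close>]
    by (elim exE conjE)
  obtain W where W: "openin T W" "x \<in> W" "\<forall>y\<in>W. g y \<in> norm.mball (g x) (e / 2)"
    using g[unfolded norm.continuous_map_to_metric, rule_format, OF x \<open>e / 2 > 0\<close>]
    by (elim exE conjE)
  show "\<exists>U. openin T U \<and> x \<in> U \<and> (\<forall>y\<in>U. f y \<oplus>\<^bsub>V\<^esub> g y \<in> norm.mball (f x \<oplus>\<^bsub>V\<^esub> g x) e)"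
  proof (intro exI[of _ "U \<inter> W"] conjI ballI)
    show "openin T (U \<inter> W)" "x \<in> U \<inter> W"
      using U W by (simp_all add: openin_Int)
    fix y assume "y \<in> U \<inter> W"
    then have y: "f y \<in> norm.mball (f x) (e / 2)" "g y \<in> norm.mball (g x) (e / 2)"
      using U(3) W(3) by blast+
    have "vdist V (f x \<oplus>\<^bsub>V\<^esub> g x) (f y \<oplus>\<^bsub>V\<^esub> g y) \<le> vdist V (f x) (f y) + vdist V (g x) (g y)"
      using y by (intro vdist_add_le) simp_all
    also have "\<dots> < e"
      using y by simp
    finally show "f y \<oplus>\<^bsub>V\<^esub> g y \<in> norm.mball (f x \<oplus>\<^bsub>V\<^esub> g x) e"
      using y by simp
  qed
qed

lemma continuous_map_smult:
  fixes T :: "'c topology"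
  assumes f: "continuous_map T (norm_topology V) f"
  shows "continuous_map T (norm_topology V) (\<lambda>x. a \<odot>\<^bsub>V\<^esub> f x)"
  unfolding norm.continuous_map_to_metric
proof (intro ballI allI impI)
  fix x and e :: real
  assume x: "x \<in> topspace T" and "e > 0"
  (* norm a may vanish, so the tolerance for f is e divided by norm a + 1. *)
  have pos: "norm a + 1 > 0"
    using norm_ge_zero[of a] by linarith
  with \<open>e > 0\<close> have "e / (norm a + 1) > 0" by simp
  from f[unfolded norm.continuous_map_to_metric, rule_format, OF x this]
  obtain U where U: "openin T U" "x \<in> U"
      "\<forall>y\<in>U. f y \<in> norm.mball (f x) (e / (norm a + 1))"
    by (elim exE conjE)
  have "a \<odot>\<^bsub>V\<^esub> f y \<in> norm.mball (a \<odot>\<^bsub>V\<^esub> f x) e" if "y \<in> U" for y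
  proof -
    have y: "f x \<in> carrier V" "f y \<in> carrier V" "vdist V (f x) (f y) < e / (norm a + 1)"
      using U(3)[rule_format, OF that] by simp_all
    have "norm a * vdist V (f x) (f y) \<le> (norm a + 1) * vdist V (f x) (f y)"
      by (intro mult_right_mono) simp_all
    also have "\<dots> < e"
      using y(3) pos by (simp add: pos_less_divide_eq mult.commute)
    finally show ?thesis
      using y by (simp add: vdist_smult smult_in_carrier)
  qed
  with U(1,2) show "\<exists>U. openin T U \<and> x \<in> U \<and> (\<forall>y\<in>U. a \<odot>\<^bsub>V\<^esub> f y \<in> norm.mball (a \<odot>\<^bsub>V\<^esub> f x) e)"
    by (intro exI[of _ U] conjI ballI)
qed

lemma norm_null_seq_add:
  assumes x: "norm_null_seq V x" and y: "norm_null_seq V y"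
  shows "norm_null_seq V (\<lambda>n. x n \<oplus>\<^bsub>V\<^esub> y n)"
  unfolding norm_null_seq_iff
proof
  have c: "x n \<in> carrier V" "y n \<in> carrier V" for n
    using x y by (simp_all add: norm_null_seq_iff)
  then show "\<forall>n. x n \<oplus>\<^bsub>V\<^esub> y n \<in> carrier V"
    by simp
  show "(\<lambda>n. vnorm V (x n \<oplus>\<^bsub>V\<^esub> y n)) \<longlonglongrightarrow> 0"
  proof (rule tendsto_sandwich)
    show "\<forall>\<^sub>F n in sequentially. 0 \<le> vnorm V (x n \<oplus>\<^bsub>V\<^esub> y n)"
      using c by (intro always_eventually allI vnorm_nonneg) simp
    show "\<forall>\<^sub>F n in sequentially. vnorm V (x n \<oplus>\<^bsub>V\<^esub> y n) \<le> vnorm V (x n) + vnorm V (y n)"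
      using c by (intro always_eventually allI vnorm_triangle)
    show "(\<lambda>n. vnorm V (x n) + vnorm V (y n)) \<longlonglongrightarrow> 0"
      using tendsto_add[of "\<lambda>n. vnorm V (x n)" 0 sequentially "\<lambda>n. vnorm V (y n)" 0] x y
      by (simp add: norm_null_seq_iff)
  qed simp
qed

lemma norm_null_seq_smult:
  assumes x: "norm_null_seq V x"
  shows "norm_null_seq V (\<lambda>n. a \<odot>\<^bsub>V\<^esub> x n)"
proof -
  have "(\<lambda>n. norm a * vnorm V (x n)) \<longlonglongrightarrow> 0"
    using x by (intro tendsto_mult_right_zero) (simp add: norm_null_seq_iff)
  then show ?thesis
    using x by (simp add: norm_null_seq_iff vnorm_smult smult_in_carrier)
qed

end

section \<open>Multilinear operators and the operator norm\<close>

locale multilinear_setting =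
  fixes m :: nat
    and E :: "nat \<Rightarrow> ('k::real_normed_field, 'a) normed_module"
    and F :: "('k, 'b) normed_module"
  assumes m_pos: "1 \<le> m"
    and E_normed: "\<And>i. i \<in> {1..m} \<Longrightarrow> normed_space (E i)"
    and F_normed: "normed_space F"
begin

sublocale F: normed_space F
  by (rule F_normed)

lemma E_monoid: "i \<in> {1..m} \<Longrightarrow> abelian_monoid (E i)"
  using E_normed by (simp add: normed_space_def module_def abelian_group_def)

lemmas E_simps =
  E_monoid[THEN abelian_monoid.a_assoc]
  E_monoid[THEN abelian_monoid.zero_closed]
  E_monoid[THEN abelian_monoid.l_zero]
  E_monoid[THEN abelian_monoid.a_closed]
  E_normed[THEN normed_space.smult_in_carrier]
  E_normed[THEN normed_space.zero_smult]
  E_normed[THEN normed_space.one_smult]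
  E_normed[THEN normed_space.smult_add_left]
  E_normed[THEN normed_space.smult_add_right]
  E_normed[THEN normed_space.smult_smult]

abbreviation "domain_space \<equiv> prod_space m E"
abbreviation "operators \<equiv> mlin_space m E F"

lemma domain_simps:
  "carrier domain_space = (\<Pi>\<^sub>E i\<in>{1..m}. carrier (E i))"
  "\<zero>\<^bsub>domain_space\<^esub> = (\<lambda>i\<in>{1..m}. \<zero>\<^bsub>E i\<^esub>)"
  "x \<oplus>\<^bsub>domain_space\<^esub> y = (\<lambda>i\<in>{1..m}. x i \<oplus>\<^bsub>E i\<^esub> y i)"
  "a \<odot>\<^bsub>domain_space\<^esub> x = (\<lambda>i\<in>{1..m}. a \<odot>\<^bsub>E i\<^esub> x i)"
  "vnorm domain_space x = (MAX i\<in>{1..m}. vnorm (E i) (x i))"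
  by (simp_all add: prod_space_def)

lemma operators_simps:
  "\<zero>\<^bsub>operators\<^esub> = (\<lambda>x\<in>carrier domain_space. \<zero>\<^bsub>F\<^esub>)"
  "A \<oplus>\<^bsub>operators\<^esub> B = (\<lambda>x\<in>carrier domain_space. A x \<oplus>\<^bsub>F\<^esub> B x)"
  "a \<odot>\<^bsub>operators\<^esub> A = (\<lambda>x\<in>carrier domain_space. a \<odot>\<^bsub>F\<^esub> A x)"
  by (simp_all add: mlin_space_def)

lemma carrier_operators_iff:
  "A \<in> carrier operators \<longleftrightarrow> A \<in> carrier domain_space \<rightarrow>\<^sub>E carrier F \<and> multilinear m E F A \<and>
    continuous_map (norm_topology domain_space) (norm_topology F) A"
  by (simp add: mlin_space_def)

lemma apply_closed: "A \<in> carrier operators \<Longrightarrow> x \<in> carrier domain_space \<Longrightarrow> A x \<in> carrier F"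
  by (auto simp: carrier_operators_iff)

text \<open>
  The maximum over the factors is taken over a nonempty index set because \<open>m \<ge> 1\<close>; for an empty one
  it would be an unspecified number.
\<close>

lemma vnorm_domain_le_iff:
  "vnorm domain_space x \<le> r \<longleftrightarrow> (\<forall>i\<in>{1..m}. vnorm (E i) (x i) \<le> r)"
  using m_pos by (auto simp: domain_simps Max_le_iff)

lemma vnorm_operators:
  "vnorm operators A =
    (SUP x\<in>{x \<in> carrier domain_space. vnorm domain_space x \<le> 1}. vnorm F (A x))"
  unfolding vnorm_domain_le_iff by (simp add: mlin_space_def)

lemma vnorm_component_le: "i \<in> {1..m} \<Longrightarrow> vnorm (E i) (x i) \<le> vnorm domain_space x"
  using vnorm_domain_le_iff by blast

lemma component_closed: "x \<in> carrier domain_space \<Longrightarrow> i \<in> {1..m} \<Longrightarrow> x i \<in> carrier (E i)"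
  by (auto simp: domain_simps)

lemma domain_eqI:
  assumes "x \<in> carrier domain_space" "y \<in> carrier domain_space" "\<And>i. i \<in> {1..m} \<Longrightarrow> x i = y i"
  shows "x = y"
  using assms unfolding domain_simps by (rule PiE_ext)

lemma normed_space_domain: "normed_space domain_space"
proof (rule normed_spaceI)
  note comp = component_closed
  show zero: "\<zero>\<^bsub>domain_space\<^esub> \<in> carrier domain_space"
    by (auto simp: domain_simps E_simps)
  show add: "x \<oplus>\<^bsub>domain_space\<^esub> y \<in> carrier domain_space"
    if "x \<in> carrier domain_space" "y \<in> carrier domain_space" for x y
    using comp[OF that(1)] comp[OF that(2)] by (simp add: domain_simps E_simps)
  show smult: "a \<odot>\<^bsub>domain_space\<^esub> x \<in> carrier domain_space"
    if "x \<in> carrier domain_space" for a x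
    using comp[OF that] by (simp add: domain_simps E_simps)
  note closed = zero add smult
  fix x y z and a b :: 'k
  assume x: "x \<in> carrier domain_space"
  show "\<zero>\<^bsub>domain_space\<^esub> \<oplus>\<^bsub>domain_space\<^esub> x = x"
    using x by (intro domain_eqI closed) (simp_all add: domain_simps(2-4) E_simps comp[OF x])
  show "0 \<odot>\<^bsub>domain_space\<^esub> x = \<zero>\<^bsub>domain_space\<^esub>"
    using x by (intro domain_eqI closed) (simp_all add: domain_simps(2-4) E_simps comp[OF x])
  show "1 \<odot>\<^bsub>domain_space\<^esub> x = x"
    using x by (intro domain_eqI closed) (simp_all add: domain_simps(2-4) E_simps comp[OF x])
  show "(a + b) \<odot>\<^bsub>domain_space\<^esub> x =
      a \<odot>\<^bsub>domain_space\<^esub> x \<oplus>\<^bsub>domain_space\<^esub> b \<odot>\<^bsub>domain_space\<^esub> x"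
    using x by (intro domain_eqI closed) (simp_all add: domain_simps(2-4) E_simps comp[OF x])
  show "(a * b) \<odot>\<^bsub>domain_space\<^esub> x = a \<odot>\<^bsub>domain_space\<^esub> (b \<odot>\<^bsub>domain_space\<^esub> x)"
    using x by (intro domain_eqI closed) (simp_all add: domain_simps(2-4) E_simps comp[OF x])
  show "0 \<le> vnorm domain_space x"
    using normed_space.vnorm_nonneg[OF E_normed comp[OF x], of 1] vnorm_component_le[of 1 x] m_pos
    by simp
  show "x = \<zero>\<^bsub>domain_space\<^esub>" if "vnorm domain_space x = 0"
  proof (intro domain_eqI closed x)
    fix i assume i: "i \<in> {1..m}"
    then have "vnorm (E i) (x i) = 0"
      using vnorm_component_le[OF i, of x] that
        normed_space.vnorm_nonneg[OF E_normed[OF i] comp[OF x i]] by simp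
    then show "x i = \<zero>\<^bsub>domain_space\<^esub> i"
      using normed_space.vnorm_eq_0[OF E_normed[OF i] comp[OF x i]] i by (simp add: domain_simps)
  qed
  show "vnorm domain_space (a \<odot>\<^bsub>domain_space\<^esub> x) = norm a * vnorm domain_space x"
  proof -
    have "vnorm domain_space (a \<odot>\<^bsub>domain_space\<^esub> x) =
        Max ((\<lambda>i. norm a * vnorm (E i) (x i)) ` {1..m})"
      unfolding domain_simps(4,5)
      by (intro arg_cong[of _ _ Max] image_cong)
         (simp_all add: normed_space.vnorm_smult[OF E_normed] comp[OF x])
    also have "\<dots> = norm a * vnorm domain_space x"
      using mono_Max_commute[of "\<lambda>t. norm a * t" "(\<lambda>i. vnorm (E i) (x i)) ` {1..m}"] m_pos
      by (simp add: domain_simps image_image mono_def mult_left_mono)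
    finally show ?thesis .
  qed
  assume y: "y \<in> carrier domain_space"
  show "x \<oplus>\<^bsub>domain_space\<^esub> y = y \<oplus>\<^bsub>domain_space\<^esub> x"
    using x y by (intro domain_eqI closed)
         (simp_all add: domain_simps(2-4) E_monoid[THEN abelian_monoid.a_comm] comp)
  show "a \<odot>\<^bsub>domain_space\<^esub> (x \<oplus>\<^bsub>domain_space\<^esub> y) =
      a \<odot>\<^bsub>domain_space\<^esub> x \<oplus>\<^bsub>domain_space\<^esub> a \<odot>\<^bsub>domain_space\<^esub> y"
    using x y by (intro domain_eqI closed) (simp_all add: domain_simps(2-4) E_simps comp)
  show "vnorm domain_space (x \<oplus>\<^bsub>domain_space\<^esub> y) \<le> vnorm domain_space x + vnorm domain_space y"
    unfolding vnorm_domain_le_iff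
  proof
    fix i assume i: "i \<in> {1..m}"
    show "vnorm (E i) ((x \<oplus>\<^bsub>domain_space\<^esub> y) i) \<le> vnorm domain_space x + vnorm domain_space y"
      using normed_space.vnorm_triangle[OF E_normed[OF i] comp[OF x i] comp[OF y i]] i
        vnorm_component_le[OF i, of x] vnorm_component_le[OF i, of y]
      by (simp add: domain_simps(3))
  qed
  assume z: "z \<in> carrier domain_space"
  show "(x \<oplus>\<^bsub>domain_space\<^esub> y) \<oplus>\<^bsub>domain_space\<^esub> z = x \<oplus>\<^bsub>domain_space\<^esub> (y \<oplus>\<^bsub>domain_space\<^esub> z)"
    using x y z by (intro domain_eqI closed) (simp_all add: domain_simps(2-4) E_simps comp)
qed

sublocale domain: normed_space domain_space
  by (rule normed_space_domain)

text \<open>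
  Scaling a vector of the product scales all \<open>m\<close> arguments. Pulling the factor out of one argument
  after the other gives the degree \<open>m\<close>; the induction runs over the set \<open>J\<close> of arguments that are
  scaled already.
\<close>

lemma multilinear_homogeneous:
  assumes A: "multilinear m E F A" "A \<in> carrier domain_space \<rightarrow> carrier F"
    and x: "x \<in> carrier domain_space"
  shows "A (a \<odot>\<^bsub>domain_space\<^esub> x) = (a ^ m) \<odot>\<^bsub>F\<^esub> A x"
proof -
  have *: "A (\<lambda>i\<in>{1..m}. if i \<in> J then a \<odot>\<^bsub>E i\<^esub> x i else x i) = (a ^ card J) \<odot>\<^bsub>F\<^esub> A x"
    if "finite J" "J \<subseteq> {1..m}" for J
    using that
  proof (induction J rule: finite_induct)
    case empty
    have "(\<lambda>i\<in>{1..m}. x i) = x"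
      using x unfolding domain_simps by (rule PiE_restrict)
    moreover have "A x \<in> carrier F"
      using A x by auto
    ultimately show ?case
      by (simp add: F.one_smult)
  next
    case (insert j J)
    define y where "y = (\<lambda>i\<in>{1..m}. if i \<in> J then a \<odot>\<^bsub>E i\<^esub> x i else x i)"
    have j: "j \<in> {1..m}"
      using insert.prems by simp
    have y: "y \<in> carrier domain_space"
      using x by (auto simp: y_def domain_simps E_simps dest: PiE_mem)
    have yj: "y j = x j"
      using j insert.hyps by (simp add: y_def)
    have eq: "(\<lambda>i\<in>{1..m}. if i \<in> insert j J then a \<odot>\<^bsub>E i\<^esub> x i else x i) = y(j := a \<odot>\<^bsub>E j\<^esub> x j)"
      using j by (auto simp: y_def fun_eq_iff)
    have "A (y(j := a \<odot>\<^bsub>E j\<^esub> x j)) = a \<odot>\<^bsub>F\<^esub> A (y(j := x j))"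
      using A(1) y j component_closed[OF x j] unfolding multilinear_def by blast
    also have "\<dots> = a \<odot>\<^bsub>F\<^esub> ((a ^ card J) \<odot>\<^bsub>F\<^esub> A x)"
      using insert.IH insert.prems yj unfolding y_def[symmetric] by (simp add: fun_upd_idem)
    also have "\<dots> = (a ^ card (insert j J)) \<odot>\<^bsub>F\<^esub> A x"
      using A x insert.hyps by (subst F.smult_smult) auto
    finally show ?case
      unfolding eq .
  qed
  have "a \<odot>\<^bsub>domain_space\<^esub> x =
      (\<lambda>i\<in>{1..m}. if i \<in> {1..m} then a \<odot>\<^bsub>E i\<^esub> x i else x i)"
    by (auto simp: domain_simps)
  then show ?thesis
    using *[of "{1..m}"] by simp
qed

lemma vnorm_apply_scale:
  assumes A: "A \<in> carrier operators" and x: "x \<in> carrier domain_space"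
  shows "vnorm F (A (a \<odot>\<^bsub>domain_space\<^esub> x)) = norm a ^ m * vnorm F (A x)"
  using A x multilinear_homogeneous[of A x a]
  by (auto simp: carrier_operators_iff F.vnorm_smult norm_power PiE_iff)

text \<open>Homogeneity with factor \<open>0\<close>; the exponent \<open>m\<close> is positive, so that \<open>0 ^ m = 0\<close>.\<close>

lemma apply_zero:
  assumes A: "A \<in> carrier operators"
  shows "A \<zero>\<^bsub>domain_space\<^esub> = \<zero>\<^bsub>F\<^esub>"
proof -
  have "vnorm F (A (0 \<odot>\<^bsub>domain_space\<^esub> \<zero>\<^bsub>domain_space\<^esub>)) = 0"
    using vnorm_apply_scale[OF A domain.M.zero_closed, of 0] m_pos by (simp add: power_0_left)
  then show ?thesis
    using A by (simp add: domain.smult_zero F.vnorm_eq_0 apply_closed)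
qed

text \<open>
  Continuity at the origin makes \<open>\<parallel>A x\<parallel> < 1\<close> for \<open>\<parallel>x\<parallel> < d\<close>. Scaling by \<open>d / 2\<close> moves the closed unit ball
  into this open ball, and by homogeneity it multiplies the values of \<open>A\<close> by \<open>(d / 2) ^ m\<close> in norm.
\<close>

lemma bounded_on_unit_ball:
  assumes A: "A \<in> carrier operators"
  shows "\<exists>K. \<forall>x\<in>carrier domain_space. vnorm domain_space x \<le> 1 \<longrightarrow> vnorm F (A x) \<le> K"
proof -
  have "continuous_map (norm_topology domain_space) (norm_topology F) A"
    using A by (simp add: carrier_operators_iff)
  then obtain d where d: "d > 0" and small:
    "\<And>x. x \<in> carrier domain_space \<Longrightarrow> vdist domain_space \<zero>\<^bsub>domain_space\<^esub> x < d \<Longrightarrow>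
      vdist F (A \<zero>\<^bsub>domain_space\<^esub>) (A x) < 1"
    unfolding domain.norm.metric_continuous_map[OF F.norm.Metric_space_axioms]
    by (meson domain.M.zero_closed zero_less_one)
  have small': "vnorm F (A x) < 1" if "x \<in> carrier domain_space" "vnorm domain_space x < d" for x
  proof -
    have "vdist F (A \<zero>\<^bsub>domain_space\<^esub>) (A x) < 1"
      using that by (intro small) (simp_all add: domain.vdist_zero_left)
    then show ?thesis
      using apply_closed[OF A that(1)] by (simp add: apply_zero[OF A] F.vdist_zero_left)
  qed
  define c :: 'k where "c = of_real (d / 2)"
  have c: "norm c = d / 2"
    using d by (simp add: c_def del: of_real_divide)
  show ?thesis
  proof (intro exI ballI impI)
    fix x assume x: "x \<in> carrier domain_space" "vnorm domain_space x \<le> 1"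
    have "vnorm domain_space (c \<odot>\<^bsub>domain_space\<^esub> x) = d / 2 * vnorm domain_space x"
      using x by (simp add: domain.vnorm_smult c)
    also have "\<dots> \<le> d / 2 * 1"
      using d x by (intro mult_left_mono) auto
    also have "\<dots> < d"
      using d by simp
    finally have "vnorm F (A (c \<odot>\<^bsub>domain_space\<^esub> x)) < 1"
      by (intro small' domain.smult_in_carrier x)
    then have "(d / 2) ^ m * vnorm F (A x) < 1"
      using vnorm_apply_scale[OF A x(1), of c] by (simp add: c)
    then show "vnorm F (A x) \<le> 1 / (d / 2) ^ m"
      using d by (simp add: pos_le_divide_eq mult.commute)
  qed
qed

text \<open>
  The supremum of an unbounded set of reals is an unspecified number, so every upper estimate of
  values by the operator norm depends on this.
\<close>

lemma bdd_above_unit_ball: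
  assumes "A \<in> carrier operators"
  shows "bdd_above ((\<lambda>x. vnorm F (A x)) ` {x \<in> carrier domain_space. vnorm domain_space x \<le> 1})"
proof -
  obtain K where "\<forall>x\<in>carrier domain_space. vnorm domain_space x \<le> 1 \<longrightarrow> vnorm F (A x) \<le> K"
    using bounded_on_unit_ball[OF assms] ..
  then show ?thesis
    by (intro bdd_aboveI2[of _ _ K]) simp
qed

lemma vnorm_apply_le:
  assumes "A \<in> carrier operators" "x \<in> carrier domain_space" "vnorm domain_space x \<le> 1"
  shows "vnorm F (A x) \<le> vnorm operators A"
  unfolding vnorm_operators
  by (rule cSUP_upper[OF _ bdd_above_unit_ball[OF assms(1)]]) (use assms in auto)

lemma vnorm_operators_leI:
  assumes "\<And>x. x \<in> carrier domain_space \<Longrightarrow> vnorm domain_space x \<le> 1 \<Longrightarrow> vnorm F (A x) \<le> K"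
  shows "vnorm operators A \<le> K"
  unfolding vnorm_operators
proof (rule cSUP_least)
  show "{x \<in> carrier domain_space. vnorm domain_space x \<le> 1} \<noteq> {}"
    using domain.M.zero_closed domain.vnorm_zero by force
qed (use assms in auto)

text \<open>
  The estimate behind closedness: rescale \<open>x\<close> to the unit ball by the factor \<open>1 / R\<close>. Using a positive
  \<open>R\<close> instead of \<open>\<parallel>x\<parallel>\<close> itself avoids a separate case for \<open>x = 0\<close>.
\<close>

lemma vnorm_apply_le_power:
  assumes A: "A \<in> carrier operators" and x: "x \<in> carrier domain_space"
    and R: "R > 0" "vnorm domain_space x \<le> R"
  shows "vnorm F (A x) \<le> R ^ m * vnorm operators A"
proof -
  define r :: 'k where "r = of_real R"
  define y where "y = inverse r \<odot>\<^bsub>domain_space\<^esub> x"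
  have r: "norm r = R" "r \<noteq> 0"
    using R by (auto simp: r_def)
  have y: "y \<in> carrier domain_space"
    using x by (simp add: y_def domain.smult_in_carrier)
  have "vnorm domain_space y = vnorm domain_space x / R"
    using x r by (simp add: y_def domain.vnorm_smult norm_inverse divide_inverse)
  then have y1: "vnorm domain_space y \<le> 1"
    using R by simp
  have "x = r \<odot>\<^bsub>domain_space\<^esub> y"
    using x r by (simp add: y_def domain.smult_smult domain.one_smult)
  then have "vnorm F (A x) = R ^ m * vnorm F (A y)"
    using vnorm_apply_scale[OF A y, of r] r by simp
  also have "\<dots> \<le> R ^ m * vnorm operators A"
    using R vnorm_apply_le[OF A y y1] by (intro mult_left_mono) auto
  finally show ?thesis .
qed

section \<open>The normed space of continuous multilinear operators\<close>

lemma update_closed: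
  "x \<in> carrier domain_space \<Longrightarrow> i \<in> {1..m} \<Longrightarrow> u \<in> carrier (E i) \<Longrightarrow> x(i := u) \<in> carrier domain_space"
  by (auto simp: domain_simps PiE_iff extensional_def)

text \<open>
  Sums and multiples of operators are restrictions of pointwise expressions to the product. With this
  rule, membership can be checked on the unrestricted expression \<open>f\<close>.
\<close>

lemma operatorI:
  assumes closed: "\<And>x. x \<in> carrier domain_space \<Longrightarrow> f x \<in> carrier F"
    and add: "\<And>x i u v. x \<in> carrier domain_space \<Longrightarrow> i \<in> {1..m} \<Longrightarrow> u \<in> carrier (E i) \<Longrightarrow>
      v \<in> carrier (E i) \<Longrightarrow> f (x(i := u \<oplus>\<^bsub>E i\<^esub> v)) = f (x(i := u)) \<oplus>\<^bsub>F\<^esub> f (x(i := v))"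
    and smult: "\<And>x i u a. x \<in> carrier domain_space \<Longrightarrow> i \<in> {1..m} \<Longrightarrow> u \<in> carrier (E i) \<Longrightarrow>
      f (x(i := a \<odot>\<^bsub>E i\<^esub> u)) = a \<odot>\<^bsub>F\<^esub> f (x(i := u))"
    and cont: "continuous_map (norm_topology domain_space) (norm_topology F) f"
  shows "(\<lambda>x\<in>carrier domain_space. f x) \<in> carrier operators"
  unfolding carrier_operators_iff
proof (intro conjI)
  show "(\<lambda>x\<in>carrier domain_space. f x) \<in> carrier domain_space \<rightarrow>\<^sub>E carrier F"
    using closed by auto
  show "multilinear m E F (\<lambda>x\<in>carrier domain_space. f x)"
    unfolding multilinear_def
  proof (intro ballI allI)
    fix x i u v and a :: 'k
    assume x: "x \<in> carrier domain_space" and i: "i \<in> {1..m}"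
      and u: "u \<in> carrier (E i)" and v: "v \<in> carrier (E i)"
    interpret Ei: normed_space "E i"
      by (rule E_normed[OF i])
    show "(\<lambda>x\<in>carrier domain_space. f x) (x(i := u \<oplus>\<^bsub>E i\<^esub> v)) =
          (\<lambda>x\<in>carrier domain_space. f x) (x(i := u)) \<oplus>\<^bsub>F\<^esub> (\<lambda>x\<in>carrier domain_space. f x) (x(i := v)) \<and>
        (\<lambda>x\<in>carrier domain_space. f x) (x(i := a \<odot>\<^bsub>E i\<^esub> u)) =
          a \<odot>\<^bsub>F\<^esub> (\<lambda>x\<in>carrier domain_space. f x) (x(i := u))"
      using add[OF x i u v] smult[OF x i u, of a] u v
      by (simp add: update_closed[OF x i] Ei.smult_in_carrier)
  qed
  show "continuous_map (norm_topology domain_space) (norm_topology F) (\<lambda>x\<in>carrier domain_space. f x)"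
    by (rule continuous_map_eq[OF cont]) simp
qed

lemma operator_add:
  assumes "A \<in> carrier operators" "x \<in> carrier domain_space" "i \<in> {1..m}" "u \<in> carrier (E i)"
    "v \<in> carrier (E i)"
  shows "A (x(i := u \<oplus>\<^bsub>E i\<^esub> v)) = A (x(i := u)) \<oplus>\<^bsub>F\<^esub> A (x(i := v))"
  using assms unfolding carrier_operators_iff multilinear_def by blast

lemma operator_smult:
  assumes "A \<in> carrier operators" "x \<in> carrier domain_space" "i \<in> {1..m}" "u \<in> carrier (E i)"
  shows "A (x(i := a \<odot>\<^bsub>E i\<^esub> u)) = a \<odot>\<^bsub>F\<^esub> A (x(i := u))"
  using assms unfolding carrier_operators_iff multilinear_def by blast

lemma operator_continuous:
  "A \<in> carrier operators \<Longrightarrow> continuous_map (norm_topology domain_space) (norm_topology F) A"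
  by (simp add: carrier_operators_iff)

lemma operator_eqI:
  assumes "A \<in> carrier operators" "B \<in> carrier operators"
    "\<And>x. x \<in> carrier domain_space \<Longrightarrow> A x = B x"
  shows "A = B"
  using assms unfolding carrier_operators_iff by (blast intro: PiE_ext)

lemma zero_operator_closed: "\<zero>\<^bsub>operators\<^esub> \<in> carrier operators"
  unfolding operators_simps by (rule operatorI) (simp_all add: F.smult_zero)

lemma add_operator_closed:
  assumes "A \<in> carrier operators" "B \<in> carrier operators"
  shows "A \<oplus>\<^bsub>operators\<^esub> B \<in> carrier operators"
  unfolding operators_simps
  by (rule operatorI)
     (use assms in \<open>simp_all add: apply_closed operator_add operator_smult update_closed F.M.a_ac
        F.smult_add_right F.continuous_map_add operator_continuous\<close>)

lemma smult_operator_closed: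
  assumes "A \<in> carrier operators"
  shows "a \<odot>\<^bsub>operators\<^esub> A \<in> carrier operators"
  unfolding operators_simps
  by (rule operatorI)
     (use assms in \<open>simp_all add: apply_closed operator_add operator_smult update_closed
        F.smult_in_carrier F.smult_smult F.smult_add_right mult.commute
        F.continuous_map_smult operator_continuous\<close>)

lemma normed_space_operators: "normed_space operators"
proof (rule normed_spaceI)
  note closed = zero_operator_closed add_operator_closed smult_operator_closed
  note simps = operators_simps apply_closed F.smult_in_carrier F.zero_smult F.one_smult
    F.smult_add_left F.smult_add_right F.smult_smult
  show "\<zero>\<^bsub>operators\<^esub> \<in> carrier operators"
    by (rule zero_operator_closed)
  fix A B C and a b :: 'k
  assume A: "A \<in> carrier operators"
  show "a \<odot>\<^bsub>operators\<^esub> A \<in> carrier operators"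
    using A by (rule closed)
  show "\<zero>\<^bsub>operators\<^esub> \<oplus>\<^bsub>operators\<^esub> A = A"
    using A by (intro operator_eqI closed) (simp_all add: simps)
  show "0 \<odot>\<^bsub>operators\<^esub> A = \<zero>\<^bsub>operators\<^esub>"
    using A by (intro operator_eqI closed) (simp_all add: simps)
  show "1 \<odot>\<^bsub>operators\<^esub> A = A"
    using A by (intro operator_eqI closed) (simp_all add: simps)
  show "(a + b) \<odot>\<^bsub>operators\<^esub> A = a \<odot>\<^bsub>operators\<^esub> A \<oplus>\<^bsub>operators\<^esub> b \<odot>\<^bsub>operators\<^esub> A"
    using A by (intro operator_eqI closed) (simp_all add: simps)
  show "(a * b) \<odot>\<^bsub>operators\<^esub> A = a \<odot>\<^bsub>operators\<^esub> (b \<odot>\<^bsub>operators\<^esub> A)"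
    using A by (intro operator_eqI closed) (simp_all add: simps)
  show nonneg: "0 \<le> vnorm operators A"
    using vnorm_apply_le[OF A domain.M.zero_closed]
    by (simp add: domain.vnorm_zero apply_zero[OF A] F.vnorm_zero)
  show "A = \<zero>\<^bsub>operators\<^esub>" if "vnorm operators A = 0"
  proof (intro operator_eqI closed A)
    fix x assume x: "x \<in> carrier domain_space"
    have "vnorm F (A x) \<le> (vnorm domain_space x + 1) ^ m * vnorm operators A"
      using domain.vnorm_nonneg[OF x] by (intro vnorm_apply_le_power A x) auto
    then have "vnorm F (A x) = 0"
      using that F.vnorm_nonneg[OF apply_closed[OF A x]] by simp
    then show "A x = \<zero>\<^bsub>operators\<^esub> x"
      using x A by (simp add: operators_simps F.vnorm_eq_0 apply_closed)
  qed
  show "vnorm operators (a \<odot>\<^bsub>operators\<^esub> A) = norm a * vnorm operators A"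
  proof (rule antisym)
    show "vnorm operators (a \<odot>\<^bsub>operators\<^esub> A) \<le> norm a * vnorm operators A"
      by (rule vnorm_operators_leI)
         (use A in \<open>simp add: operators_simps F.vnorm_smult apply_closed vnorm_apply_le mult_left_mono\<close>)
    show "norm a * vnorm operators A \<le> vnorm operators (a \<odot>\<^bsub>operators\<^esub> A)"
    proof (cases "a = 0")
      case True
      (* The value at the origin shows that the norm on the right is nonnegative. *)
      have "vnorm F ((a \<odot>\<^bsub>operators\<^esub> A) \<zero>\<^bsub>domain_space\<^esub>) \<le> vnorm operators (a \<odot>\<^bsub>operators\<^esub> A)"
        by (rule vnorm_apply_le) (simp_all add: closed A domain.vnorm_zero)
      then show ?thesis
        using True apply_zero[OF smult_operator_closed[OF A]] by (simp add: F.vnorm_zero)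
    next
      case False
      have "vnorm operators A \<le> vnorm operators (a \<odot>\<^bsub>operators\<^esub> A) / norm a"
      proof (rule vnorm_operators_leI)
        fix x assume x: "x \<in> carrier domain_space" "vnorm domain_space x \<le> 1"
        have "norm a * vnorm F (A x) \<le> vnorm operators (a \<odot>\<^bsub>operators\<^esub> A)"
          using vnorm_apply_le[OF smult_operator_closed[OF A] x, of a] x A
          by (simp add: operators_simps F.vnorm_smult apply_closed)
        then show "vnorm F (A x) \<le> vnorm operators (a \<odot>\<^bsub>operators\<^esub> A) / norm a"
          using False by (simp add: pos_le_divide_eq mult.commute)
      qed
      then show ?thesis
        using False by (simp add: pos_le_divide_eq mult.commute)
    qed
  qed
  assume B: "B \<in> carrier operators"
  show "A \<oplus>\<^bsub>operators\<^esub> B \<in> carrier operators"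
    using A B by (rule closed)
  show "A \<oplus>\<^bsub>operators\<^esub> B = B \<oplus>\<^bsub>operators\<^esub> A"
    using A B by (intro operator_eqI closed) (simp_all add: simps F.M.a_comm)
  show "a \<odot>\<^bsub>operators\<^esub> (A \<oplus>\<^bsub>operators\<^esub> B) = a \<odot>\<^bsub>operators\<^esub> A \<oplus>\<^bsub>operators\<^esub> a \<odot>\<^bsub>operators\<^esub> B"
    using A B by (intro operator_eqI closed) (simp_all add: simps)
  show "vnorm operators (A \<oplus>\<^bsub>operators\<^esub> B) \<le> vnorm operators A + vnorm operators B"
  proof (rule vnorm_operators_leI)
    fix x assume x: "x \<in> carrier domain_space" "vnorm domain_space x \<le> 1"
    have "vnorm F (A x \<oplus>\<^bsub>F\<^esub> B x) \<le> vnorm F (A x) + vnorm F (B x)"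
      using A B x by (intro F.vnorm_triangle apply_closed)
    also have "\<dots> \<le> vnorm operators A + vnorm operators B"
      using A B x by (intro add_mono vnorm_apply_le)
    finally show "vnorm F ((A \<oplus>\<^bsub>operators\<^esub> B) x) \<le> vnorm operators A + vnorm operators B"
      using x by (simp add: operators_simps)
  qed
  assume C: "C \<in> carrier operators"
  show "(A \<oplus>\<^bsub>operators\<^esub> B) \<oplus>\<^bsub>operators\<^esub> C = A \<oplus>\<^bsub>operators\<^esub> (B \<oplus>\<^bsub>operators\<^esub> C)"
    using A B C by (intro operator_eqI closed) (simp_all add: simps F.M.a_assoc)
qed

sublocale operators: normed_space operators
  by (rule normed_space_operators)

section \<open>Operators sending prescribed bounded sequences to null sequences\<close>

text \<open>
  An \<open>\<epsilon>/2\<close> argument. The approximating operator \<open>A\<close> may depend on \<open>e\<close>, since the error \<open>(L - A) (x n)\<close>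
  is bounded by \<open>R ^ m * \<parallel>L - A\<parallel>\<close> for all \<open>n\<close> at once; this is where boundedness of \<open>x\<close> enters.
\<close>

lemma norm_null_seq_of_approximations:
  assumes L: "L \<in> carrier operators" and x: "bounded_seq domain_space x"
    and approx: "\<And>e. e > 0 \<Longrightarrow>
      \<exists>A\<in>carrier operators. vdist operators A L < e \<and> norm_null_seq F (\<lambda>n. A (x n))"
  shows "norm_null_seq F (\<lambda>n. L (x n))"
proof -
  have xc: "x n \<in> carrier domain_space" for n
    using x by (auto simp: bounded_seq_def image_subset_iff)
  obtain B where B: "\<And>n. vnorm domain_space (x n) \<le> B"
    using x by (auto simp: bounded_seq_def image_subset_iff)
  (* The bound B may be 0, but the rescaling needs a positive radius. *)
  define R where "R = max B 1"
  have R: "R > 0" "\<And>n. vnorm domain_space (x n) \<le> R"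
    using B by (auto simp: R_def le_max_iff_disj)
  have "(\<lambda>n. vnorm F (L (x n))) \<longlonglongrightarrow> 0"
  proof (rule LIMSEQ_I)
    fix e :: real assume e: "e > 0"
    then have "e / (2 * R ^ m) > 0"
      using R by simp
    from approx[OF this] obtain A where A: "A \<in> carrier operators"
      and dist: "vdist operators A L < e / (2 * R ^ m)" and null: "norm_null_seq F (\<lambda>n. A (x n))"
      by blast
    have D: "L \<ominus>\<^bsub>operators\<^esub> A \<in> carrier operators"
      using A L by simp
    have close: "R ^ m * vnorm operators (L \<ominus>\<^bsub>operators\<^esub> A) < e / 2"
    proof -
      have "vnorm operators (L \<ominus>\<^bsub>operators\<^esub> A) < e / (2 * R ^ m)"
        using dist A L operators.norm.commute[of "A" L] by (simp add: vdist_def)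
      then show ?thesis
        using R by (simp add: field_simps)
    qed
    have "(\<lambda>n. vnorm F (A (x n))) \<longlonglongrightarrow> 0"
      using null by (simp add: norm_null_seq_iff)
    from LIMSEQ_D[OF this half_gt_zero[OF e]] obtain N where
      N: "\<And>n. n \<ge> N \<Longrightarrow> norm (vnorm F (A (x n)) - 0) < e / 2"
      by blast
    have "vnorm F (L (x n)) < e" if "n \<ge> N" for n
    proof -
      have Lx: "L (x n) \<in> carrier F" "A (x n) \<in> carrier F"
        using apply_closed A L xc by blast+
      have diff: "(L \<ominus>\<^bsub>operators\<^esub> A) (x n) = L (x n) \<ominus>\<^bsub>F\<^esub> A (x n)"
        using xc A L Lx
        by (simp add: operators.minus_eq_smult F.minus_eq_smult operators_simps)
      have "L (x n) = (L \<ominus>\<^bsub>operators\<^esub> A) (x n) \<oplus>\<^bsub>F\<^esub> A (x n)"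
        unfolding diff using Lx by (simp add: a_minus_def F.M.a_assoc F.M.l_neg)
      then have "vnorm F (L (x n)) \<le> vnorm F ((L \<ominus>\<^bsub>operators\<^esub> A) (x n)) + vnorm F (A (x n))"
        using F.vnorm_triangle[OF apply_closed[OF D xc] Lx(2), of n] by simp
      also have "\<dots> < e / 2 + e / 2"
        using vnorm_apply_le_power[OF D xc R(1) R(2), of n] close N[OF that] by simp
      finally show ?thesis by simp
    qed
    then show "\<exists>N. \<forall>n\<ge>N. norm (vnorm F (L (x n)) - 0) < e"
      using F.vnorm_nonneg apply_closed[OF L xc] by (intro exI[of _ N]) simp
  qed
  then show ?thesis
    using apply_closed[OF L xc] by (simp add: norm_null_seq_iff)
qed

lemma closed_subspace_null_operators:
  "closed_subspace
    {A \<in> carrier operators.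
      \<forall>x. bounded_seq domain_space x \<and> P x \<longrightarrow> norm_null_seq F (\<lambda>n. A (x n))}
    operators"
  (is "closed_subspace ?S _")
proof -
  have range: "x n \<in> carrier domain_space" if "bounded_seq domain_space x" for x n
    using that by (auto simp: bounded_seq_def image_subset_iff)
  have "norm_null_seq F (\<lambda>n. \<zero>\<^bsub>operators\<^esub> (x n))" if "bounded_seq domain_space x" for x
    using that by (simp add: operators_simps range norm_null_seq_iff F.vnorm_zero)
  then have zero: "\<zero>\<^bsub>operators\<^esub> \<in> ?S"
    by (simp add: zero_operator_closed)
  have add: "A \<oplus>\<^bsub>operators\<^esub> B \<in> ?S" if "A \<in> ?S" "B \<in> ?S" for A B
  proof -
    have "norm_null_seq F (\<lambda>n. (A \<oplus>\<^bsub>operators\<^esub> B) (x n))" if "bounded_seq domain_space x" "P x" for x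
      using F.norm_null_seq_add[of "\<lambda>n. A (x n)" "\<lambda>n. B (x n)"] \<open>A \<in> ?S\<close> \<open>B \<in> ?S\<close> that
      by (simp add: operators_simps range)
    then show ?thesis
      using that by (simp add: add_operator_closed)
  qed
  have smult: "a \<odot>\<^bsub>operators\<^esub> A \<in> ?S" if "A \<in> ?S" for a A
  proof -
    have "norm_null_seq F (\<lambda>n. (a \<odot>\<^bsub>operators\<^esub> A) (x n))" if "bounded_seq domain_space x" "P x" for x
      using F.norm_null_seq_smult[of "\<lambda>n. A (x n)" a] \<open>A \<in> ?S\<close> that
      by (simp add: operators_simps range)
    then show ?thesis
      using that by (simp add: smult_operator_closed)
  qed
  have "submodule ?S ring_of_type_algebra operators"
  proof (rule operators.submoduleI)
    show "\<ominus>\<^bsub>operators\<^esub> A \<in> ?S" if "A \<in> ?S" for A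
      using smult[OF that, of "-1"] that operators.uminus_eq_smult[of A] by simp
  qed (use zero add smult in auto)
  moreover have "closedin (norm_topology operators) ?S"
    unfolding operators.norm.metric_closedin_iff_sequentially_closed
  proof (intro conjI allI impI)
    show "?S \<subseteq> carrier operators"
      by blast
    fix \<sigma> L
    assume "range \<sigma> \<subseteq> ?S \<and> limitin operators.norm.mtopology \<sigma> L sequentially"
    then have \<sigma>: "\<And>k. \<sigma> k \<in> ?S"
      and lim: "limitin operators.norm.mtopology \<sigma> L sequentially"
      by auto
    have L: "L \<in> carrier operators"
      using lim by (simp add: operators.norm.limit_metric_sequentially)
    have near: "\<exists>k. vdist operators (\<sigma> k) L < e" if "e > 0" for e
      using lim that unfolding operators.norm.limit_metric_sequentially by blast
    have "norm_null_seq F (\<lambda>n. L (x n))" if x: "bounded_seq domain_space x" "P x" for x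
    proof (rule norm_null_seq_of_approximations[OF L x(1)])
      fix e :: real assume "e > 0"
      then obtain k where "vdist operators (\<sigma> k) L < e"
        using near by blast
      then show "\<exists>A\<in>carrier operators. vdist operators A L < e \<and> norm_null_seq F (\<lambda>n. A (x n))"
        using \<sigma>[of k] x by blast
    qed
    with L show "L \<in> ?S"
      by simp
  qed
  ultimately show ?thesis
    unfolding closed_subspace_def ..
qed

end

theorem proposition4p1:
  fixes m :: nat
    and E :: "nat \<Rightarrow> ('k::real_normed_field, 'a) normed_module"
    and F :: "('k, 'b) normed_module"
    and P :: "(nat \<Rightarrow> (nat \<Rightarrow> 'a)) \<Rightarrow> bool"
  assumes "1 \<le> m"
    and "\<And>i. i \<in> {1..m} \<Longrightarrow> Banach_space (E i)"
    and "Banach_space F"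
  shows "closed_subspace
    {A \<in> carrier (mlin_space m E F).
      \<forall>x. bounded_seq (prod_space m E) x \<and> P x \<longrightarrow> norm_null_seq F (\<lambda>n. A (x n))}
    (mlin_space m E F)"
proof -
  interpret multilinear_setting m E F
    using assms by (intro multilinear_setting.intro Banach_space.axioms(1))
  show ?thesis
    by (rule closed_subspace_null_operators)
qed

end
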